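(* Let $q$ be a prime power with $q\equiv 1\pmod 4$, and let $S_q$ be the number of (possibly non-monic) quadratic polynomials in $\mathbb{F}_q[x]$ that are stable over $\mathbb{F}_q$. Then $$S_q\geq \frac{q^2-1}{2}.$$
   Context: For a field $K$, a polynomial $t(x)\in K[x]$ is called stable over $K$ if for every integer $n\ge 1$ the $n$-th iterate $t^{(n)}(x)=t(t(\cdots t(x)\cdots))$ ($n$-fold composition) is irreducible over $K$. A quadratic polynomial is a polynomial of degree exactly $2$. *)

theory Defs
  imports
    "HOL-Computational_Algebra.Computational_Algebra"
    "HOL-Number_Theory.Cong"
    "HOL-Number_Theory.Prime_Powers"
    "HOL-Library.Cardinality"
begin

definition poly_iterate :: "nat \<Rightarrow> 'a::comm_semiring_1 poly \<Rightarrow> 'a poly" where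
  "poly_iterate n t = (pcompose t ^^ n) [:0, 1:]"

definition stable_poly :: "'a::field poly \<Rightarrow> bool" where
  "stable_poly t \<longleftrightarrow> (\<forall>n\<ge>1. irreducible (poly_iterate n t))"

end

theory Submission
  imports Defs
begin

text \<open>
  If \<open>Q\<close> is irreducible and \<open>Q(x\<^sup>2) = A B\<close>, then comparing the norms \<open>A(x) A(-x)\<close> and \<open>B(x) B(-x)\<close>
  with \<open>Q(x\<^sup>2)\<^sup>2\<close> shows that the factorization is trivial unless \<open>A(x) A(-x) = c Q(x\<^sup>2)\<close>, and in that
  case \<open>\<plusminus>lc(Q) Q(0)\<close> is a square. Iterating this, a quadratic polynomial \<open>f\<close> with leading coefficient
  \<open>a\<close> and critical point \<open>\<gamma>\<close> over a field in which \<open>-1\<close> is a square is stable as soon as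
  no \<open>a f\<^sup>n(\<gamma>)\<close> with \<open>n \<ge> 1\<close> is a square.
  There are enough polynomials with a very short critical orbit: for a nonsquare \<open>s\<close>, take
  \<open>\<gamma> = s / a\<close> to be a fixed point; and for one \<open>s\<close> such that \<open>s\<close> and \<open>s - 1\<close> are both nonsquares, take
  \<open>\<gamma> \<mapsto> (s - 1) / a \<mapsto> \<gamma>\<close>. This gives \<open>(q - 1) ((q - 1) / 2 + 1)\<close> stable polynomials.
\<close>

section \<open>Irreducibility of \<open>Q(x\<^sup>2)\<close>\<close>

lemma degree_eq_0_imp_is_unit:
  fixes p :: "'a::field poly"
  assumes "degree p = 0" "p \<noteq> 0"
  shows "p dvd 1"
  using assms by (auto simp: is_unit_poly_iff dvd_field_iff elim!: degree_eq_zeroE)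

lemma even_odd_decomposition:
  fixes p :: "'a::comm_ring_1 poly"
  obtains e d where "p = pcompose e [:0, 0, 1:] + [:0, 1:] * pcompose d [:0, 0, 1:]"
proof -
  have "\<exists>e d. p = pcompose e [:0, 0, 1:] + [:0, 1:] * pcompose d [:0, 0, 1:]"
  proof (induction p)
    case 0
    show ?case by (intro exI[of _ 0]) simp
  next
    case (pCons c p)
    then obtain e d where p: "p = pcompose e [:0, 0, 1:] + [:0, 1:] * pcompose d [:0, 0, 1:]"
      by blast
    \<comment> \<open>Multiplication by \<open>x\<close> swaps the even and the odd part; the
      constant \<open>c\<close> joins the new even part.\<close>
    have "pCons c p = pcompose (pCons c d) [:0, 0, 1:] + [:0, 1:] * pcompose e [:0, 0, 1:]"
      by (subst p) (simp add: pcompose_pCons algebra_simps)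
    then show ?case by blast
  qed
  with that show ?thesis by blast
qed

text \<open>If \<open>E\<close> and \<open>x * D\<close> are the even and odd parts, the product is
  \<open>(E + x * D) * (E - x * D) = E^2 - x^2 * D^2\<close>, which is even.\<close>

lemma mult_reflect_eq_pcompose_square:
  fixes p :: "'a::comm_ring_1 poly"
  obtains r where "p * pcompose p [:0, -1:] = pcompose r [:0, 0, 1:]"
proof -
  obtain e d where p: "p = pcompose e [:0, 0, 1:] + [:0, 1:] * pcompose d [:0, 0, 1:]"
    by (rule even_odd_decomposition)
  have sq: "pcompose [:0, 0, 1:] [:0, -1:] = ([:0, 0, 1:] :: 'a poly)"
    by (simp add: pcompose_pCons)
  have "pcompose p [:0, -1:] = pcompose e [:0, 0, 1:] - [:0, 1:] * pcompose d [:0, 0, 1:]"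
    by (subst p) (simp add: pcompose_add pcompose_mult pcompose_pCons sq flip: pcompose_assoc)
  then have "p * pcompose p [:0, -1:] =
      (pcompose e [:0, 0, 1:] + [:0, 1:] * pcompose d [:0, 0, 1:]) *
      (pcompose e [:0, 0, 1:] - [:0, 1:] * pcompose d [:0, 0, 1:])"
    by (simp only: p [symmetric])
  also have "\<dots> = pcompose e [:0, 0, 1:] * pcompose e [:0, 0, 1:]
      - [:0, 1:] * [:0, 1:] * (pcompose d [:0, 0, 1:] * pcompose d [:0, 0, 1:])"
    by (simp only: algebra_simps)
  also have "\<dots> = pcompose (e * e - [:0, 1:] * d * d) [:0, 0, 1:]"
    by (simp add: pcompose_diff pcompose_mult pcompose_pCons)
  finally show ?thesis by (rule that)
qed

text \<open>Comparing leading coefficients gives \<open>lead_coeff A ^ 2\<close> up to the sign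
  \<open>(-1) ^ degree A\<close>, and evaluating at 0 gives \<open>poly A 0 ^ 2\<close>; the two
  signs cancel.\<close>

lemma mult_reflect_square_class:
  fixes A q :: "'a::field poly"
  assumes "A * pcompose A [:0, -1:] = pcompose q [:0, 0, 1:]"
  shows "degree q = degree A" "is_square ((-1) ^ degree q * lead_coeff q * poly q 0)"
proof -
  have "degree (A * pcompose A [:0, -1:]) = 2 * degree A"
    by (cases "A = 0") (simp_all add: degree_mult_eq pcompose_eq_0_iff degree_pcompose)
  then show deg: "degree q = degree A"
    using assms by (simp add: degree_pcompose)
  have "lead_coeff (pcompose q [:0, 0, 1:]) = lead_coeff q"
    by (simp add: lead_coeff_comp)
  then have "lead_coeff q = (-1) ^ degree A * lead_coeff A ^ 2"
    by (simp add: assms [symmetric] lead_coeff_mult lead_coeff_comp power2_eq_square mult_ac)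
  moreover have "poly q 0 = poly A 0 ^ 2"
    using arg_cong [OF assms, of "\<lambda>p. poly p 0"] by (simp add: poly_pcompose power2_eq_square)
  ultimately have "(-1) ^ degree q * lead_coeff q * poly q 0 =
      ((-1) ^ degree A * (-1) ^ degree A) * (lead_coeff A * poly A 0) ^ 2"
    by (simp add: deg power_mult_distrib)
  also have "\<dots> = (lead_coeff A * poly A 0) ^ 2"
    by (simp flip: power_mult_distrib)
  finally show "is_square ((-1) ^ degree q * lead_coeff q * poly q 0)"
    by simp
qed

lemma irreducible_pcompose_square:
  fixes q :: "'a::field poly"
  assumes irr: "irreducible q"
    and nonsquare: "\<not> is_square ((-1) ^ degree q * lead_coeff q * poly q 0)"
  shows "irreducible (pcompose q [:0, 0, 1:])"
proof -
  let ?sq = "\<lambda>p :: 'a poly. pcompose p [:0, 0, 1:]"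
  have "q \<noteq> 0" "\<not> q dvd 1"
    using irr by (auto dest: irreducible_not_unit)
  \<comment> \<open>If \<open>q\<close> divides the norm \<open>r\<close> of \<open>A\<close>, then
    \<open>r = q * k\<close> and \<open>q = k * s\<close>. A unit \<open>k\<close> makes
    \<open>r\<close> a scalar multiple of \<open>q\<close>, so that the square attached to
    \<open>r\<close> contradicts \<open>nonsquare\<close>; a unit \<open>s\<close> forces
    \<open>B\<close> to be constant.\<close>
  have unit_half: "A dvd 1 \<or> B dvd 1"
    if r: "A * pcompose A [:0, -1:] = ?sq r" and s: "B * pcompose B [:0, -1:] = ?sq s"
      and rs: "r * s = q * q" and "q dvd r" for A B r s
  proof -
    have "r \<noteq> 0" "s \<noteq> 0"
      using rs \<open>q \<noteq> 0\<close> by auto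
    then have "A \<noteq> 0" "B \<noteq> 0"
      using r s by (auto simp: pcompose_eq_0_iff)
    obtain k where k: "r = q * k"
      using \<open>q dvd r\<close> by blast
    then have "q = k * s"
      using rs \<open>q \<noteq> 0\<close> by simp
    then have "k dvd 1 \<or> s dvd 1"
      using irr by (rule irreducibleD [rotated])
    then show ?thesis
    proof
      assume "k dvd 1"
      then obtain c where "k = [:c:]" "c dvd 1"
        by (auto simp: is_unit_poly_iff)
      then have c: "k = [:c:]" "c \<noteq> 0"
        by auto
      then have rq: "r = smult c q" using k by simp
      have "is_square ((-1) ^ degree r * lead_coeff r * poly r 0)"
        using r by (rule mult_reflect_square_class)
      then obtain y where "(-1) ^ degree r * lead_coeff r * poly r 0 = y ^ 2"
        by (auto elim: is_nth_powerE)
      then have "(-1) ^ degree q * lead_coeff q * poly q 0 = (y / c) ^ 2"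
        using c by (simp add: rq field_simps power2_eq_square)
      with nonsquare show ?thesis by simp
    next
      assume "s dvd 1"
      then have "degree B = 0"
        using mult_reflect_square_class(1) [OF s] by (auto simp: is_unit_poly_iff)
      with \<open>B \<noteq> 0\<close> show ?thesis by (simp add: degree_eq_0_imp_is_unit)
    qed
  qed
  show ?thesis
  proof (rule irreducibleI)
    show "?sq q \<noteq> 0"
      using \<open>q \<noteq> 0\<close> by (simp add: pcompose_eq_0_iff)
    show "\<not> ?sq q dvd 1"
    proof
      assume "?sq q dvd 1"
      then have "degree (?sq q) = 0" by (auto simp: is_unit_poly_iff)
      then have "degree q = 0" by (simp add: degree_pcompose)
      with \<open>q \<noteq> 0\<close> \<open>\<not> q dvd 1\<close> show False by (simp add: degree_eq_0_imp_is_unit)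
    qed
  next
    fix A B assume AB: "?sq q = A * B"
    obtain r where r: "A * pcompose A [:0, -1:] = ?sq r"
      by (rule mult_reflect_eq_pcompose_square)
    obtain s where s: "B * pcompose B [:0, -1:] = ?sq s"
      by (rule mult_reflect_eq_pcompose_square)
    \<comment> \<open>An even polynomial equals its reflection, so its square is the product of the
      norms of \<open>A\<close> and \<open>B\<close>.\<close>
    have "pcompose (?sq q) [:0, -1:] = ?sq q"
      by (simp add: pcompose_pCons flip: pcompose_assoc)
    then have "?sq q * ?sq q = (A * B) * pcompose (A * B) [:0, -1:]"
      by (simp add: AB)
    also have "\<dots> = (A * pcompose A [:0, -1:]) * (B * pcompose B [:0, -1:])"
      by (simp only: pcompose_mult mult_ac)
    also have "\<dots> = ?sq (r * s)"
      by (simp add: r s pcompose_mult)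
    finally have "?sq (r * s - q * q) = 0"
      by (simp add: pcompose_diff pcompose_mult)
    then have rs: "r * s = q * q"
      by (simp add: pcompose_eq_0_iff)
    have "q dvd r \<or> q dvd s"
      using field_poly_irreducible_imp_prime [OF irr] rs
      by (metis dvd_triv_left prime_elem_dvd_mult_iff)
    then show "A dvd 1 \<or> B dvd 1"
    proof
      assume "q dvd r"
      with r s rs show ?thesis by (rule unit_half)
    next
      assume "q dvd s"
      moreover have "s * r = q * q" using rs by (simp add: mult.commute)
      ultimately show ?thesis using unit_half [OF s r] by blast
    qed
  qed
qed

text \<open>Substituting \<open>a + b * x\<close> is an automorphism of the polynomial ring, with
  inverse the substitution of \<open>(x - a) / b\<close>.\<close>

lemma irreducible_pcompose_linear:
  fixes p :: "'a::field poly"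
  assumes "irreducible p" "b \<noteq> 0"
  shows "irreducible (pcompose p [:a, b:])"
proof -
  have inv: "pcompose (pcompose p' [:a, b:]) [:-a / b, 1 / b:] = p'" for p'
    using \<open>b \<noteq> 0\<close> by (simp add: pcompose_pCons flip: pcompose_assoc)
  have unit: "pcompose u [:c, d:] dvd 1" if "u dvd 1" for u :: "'a poly" and c d
    using that by (auto simp: is_unit_poly_iff)
  show ?thesis
  proof (rule irreducibleI)
    show "pcompose p [:a, b:] \<noteq> 0"
      using assms inv[of p] by auto
    show "\<not> pcompose p [:a, b:] dvd 1"
      using unit[of "pcompose p [:a, b:]"] inv[of p] irreducible_not_unit [OF assms(1)] by metis
  next
    fix A B assume "pcompose p [:a, b:] = A * B"
    then have "p = pcompose A [:-a / b, 1 / b:] * pcompose B [:-a / b, 1 / b:]"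
      using inv[of p] by (simp add: pcompose_mult)
    then have "pcompose A [:-a / b, 1 / b:] dvd 1 \<or> pcompose B [:-a / b, 1 / b:] dvd 1"
      by (rule irreducibleD [OF assms(1)])
    moreover have "pcompose (pcompose p' [:-a / b, 1 / b:]) [:a, b:] = p'" for p'
      using \<open>b \<noteq> 0\<close> by (simp add: pcompose_pCons flip: pcompose_assoc)
    ultimately show "A dvd 1 \<or> B dvd 1"
      using unit by metis
  qed
qed

section \<open>A stability criterion\<close>

text \<open>The definition adds a copy of \<open>t\<close> on the outside; the stability induction
  needs it on the inside, where the square is substituted.\<close>

lemma poly_iterate_Suc_right: "poly_iterate (Suc n) t = pcompose (poly_iterate n t) t"
proof (induction n)
  case (Suc n)
  have "poly_iterate (Suc (Suc n)) t = pcompose t (poly_iterate (Suc n) t)"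
    by (simp add: poly_iterate_def)
  also have "\<dots> = pcompose (pcompose t (poly_iterate n t)) t"
    by (simp add: Suc pcompose_assoc)
  also have "pcompose t (poly_iterate n t) = poly_iterate (Suc n) t"
    by (simp add: poly_iterate_def)
  finally show ?case .
qed (simp add: poly_iterate_def pcompose_pCons)

lemma poly_poly_iterate: "poly (poly_iterate n t) x = (poly t ^^ n) x"
  by (induction n) (simp_all add: poly_iterate_def poly_pcompose)

lemma degree_poly_iterate:
  fixes t :: "'a::idom poly"
  shows "degree (poly_iterate n t) = degree t ^ n"
  by (induction n) (simp_all add: poly_iterate_def degree_pcompose)

text \<open>Here \<open>s / a\<close> is the critical point and \<open>m / a\<close> the critical value.\<close>

definition crit_quadratic :: "'a::field \<Rightarrow> 'a \<Rightarrow> 'a \<Rightarrow> 'a poly" where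
  "crit_quadratic a s m = [:(s ^ 2 + m) / a, - 2 * s, a:]"

lemma degree_crit_quadratic [simp]: "a \<noteq> 0 \<Longrightarrow> degree (crit_quadratic a s m) = 2"
  by (simp add: crit_quadratic_def)

lemma lead_coeff_crit_quadratic: "a \<noteq> 0 \<Longrightarrow> lead_coeff (crit_quadratic a s m) = a"
  by (simp add: crit_quadratic_def)

lemma poly_crit_quadratic:
  "a \<noteq> 0 \<Longrightarrow> poly (crit_quadratic a s m) x = ((a * x - s) ^ 2 + m) / a"
  by (simp add: crit_quadratic_def field_simps power2_eq_square)

lemma crit_quadratic_decomposition:
  "a \<noteq> 0 \<Longrightarrow> crit_quadratic a s m =
     pcompose (pcompose [:m / a, 1 / a:] [:0, 0, 1:]) [:- s, a:]"
  by (simp add: crit_quadratic_def pcompose_pCons field_simps power2_eq_square)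

text \<open>The leading coefficient is \<open>a ^ (2 ^ n - 1)\<close>; the extra factor
  \<open>a\<close> avoids the subtraction.\<close>

lemma lead_coeff_poly_iterate_crit_quadratic:
  assumes "a \<noteq> 0"
  shows "lead_coeff (poly_iterate n (crit_quadratic a s m)) * a = a ^ (2 ^ n)"
proof (induction n)
  case 0
  show ?case by (simp add: poly_iterate_def)
next
  case (Suc n)
  let ?t = "crit_quadratic a s m"
  have "lead_coeff (poly_iterate (Suc n) ?t) * a =
      (lead_coeff (poly_iterate n ?t) * a) * a ^ (2 ^ n)"
    using assms lead_coeff_crit_quadratic [OF assms, of s m]
    by (simp add: poly_iterate_Suc_right lead_coeff_comp degree_poly_iterate)
  then show ?case
    by (simp only: Suc power_Suc mult_2 power_add)
qed

text \<open>Writing \<open>f\<close> for the quadratic, \<open>f^(n+1)(x) = q((a * x - s)^2)\<close>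
  with \<open>q(x) = f^n((x + m) / a)\<close>, so irreducibility passes from \<open>f^n\<close> to
  \<open>q\<close> to \<open>q(x^2)\<close> to \<open>f^(n+1)\<close>. The orbit starts at the
  critical value \<open>m / a\<close>, hence \<open>n = 0\<close> is included.\<close>

lemma stable_crit_quadratic:
  fixes a s m :: "'a::field"
  assumes "a \<noteq> 0" and minus1: "is_square (-1 :: 'a)"
    and orbit: "\<And>n. \<not> is_square (a * (poly (crit_quadratic a s m) ^^ n) (m / a))"
  shows "stable_poly (crit_quadratic a s m)"
proof -
  let ?t = "crit_quadratic a s m"
  have "irreducible (poly_iterate n ?t)" for n
  proof (induction n)
    case 0
    show ?case by (simp add: poly_iterate_def irreducible_linear_field_poly)
  next
    case (Suc n)
    define q where "q = pcompose (poly_iterate n ?t) [:m / a, 1 / a:]"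
    have "irreducible q"
      unfolding q_def using \<open>a \<noteq> 0\<close> by (intro irreducible_pcompose_linear Suc) auto
    have lc: "lead_coeff q = 1 / a"
      using lead_coeff_poly_iterate_crit_quadratic [OF \<open>a \<noteq> 0\<close>, of n s m] \<open>a \<noteq> 0\<close>
      by (simp add: q_def lead_coeff_comp degree_poly_iterate field_simps)
    have q0: "poly q 0 = (poly ?t ^^ n) (m / a)"
      by (simp add: q_def poly_pcompose poly_poly_iterate)
    have "\<not> is_square ((-1) ^ degree q * lead_coeff q * poly q 0)"
    proof
      assume "is_square ((-1) ^ degree q * lead_coeff q * poly q 0)"
      then obtain y where y: "(-1) ^ degree q * lead_coeff q * poly q 0 = y ^ 2"
        by (auto elim: is_nth_powerE)
      obtain i :: 'a where "-1 = i ^ 2"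
        using minus1 by (auto elim: is_nth_powerE)
      \<comment> \<open>A square root of the sign removes it, and a factor \<open>a ^ 2\<close>
        turns the leading coefficient \<open>1 / a\<close> into \<open>a\<close>.\<close>
      then have "(i ^ degree q) ^ 2 = (-1) ^ degree q"
        by (metis power_mult mult.commute)
      then have "(a * i ^ degree q * y) ^ 2 = a ^ 2 * (-1) ^ degree q * y ^ 2"
        by (simp add: power_mult_distrib)
      also have "\<dots> = ((-1) ^ degree q * (-1) ^ degree q) * (a ^ 2 * lead_coeff q * poly q 0)"
        by (simp only: mult_ac flip: y)
      also have "\<dots> = a * (poly ?t ^^ n) (m / a)"
        using \<open>a \<noteq> 0\<close> by (simp add: lc q0 power2_eq_square flip: power_mult_distrib)
      finally show False
        using orbit[of n] by (metis is_nth_power_nth_power)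
    qed
    with \<open>irreducible q\<close> have "irreducible (pcompose q [:0, 0, 1:])"
      by (rule irreducible_pcompose_square)
    then have "irreducible (pcompose (pcompose q [:0, 0, 1:]) [:- s, a:])"
      using \<open>a \<noteq> 0\<close> by (rule irreducible_pcompose_linear)
    also have "pcompose (pcompose q [:0, 0, 1:]) [:- s, a:] = poly_iterate (Suc n) ?t"
      unfolding q_def poly_iterate_Suc_right
      by (subst (2) crit_quadratic_decomposition [OF \<open>a \<noteq> 0\<close>]) (simp only: pcompose_assoc)
    finally show ?case .
  qed
  then show ?thesis by (simp add: stable_poly_def)
qed

text \<open>For \<open>m = s\<close> the critical point \<open>s / a\<close> is fixed, so the orbit
  condition only concerns \<open>a * (s / a) = s\<close>.\<close>

lemma stable_crit_quadratic_fixed: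
  fixes a s :: "'a::field"
  assumes "a \<noteq> 0" "is_square (-1 :: 'a)" "\<not> is_square s"
  shows "stable_poly (crit_quadratic a s s)"
proof (rule stable_crit_quadratic)
  fix n
  have "(poly (crit_quadratic a s s) ^^ n) (s / a) = s / a"
    using \<open>a \<noteq> 0\<close> by (induction n) (simp_all add: poly_crit_quadratic)
  then show "\<not> is_square (a * (poly (crit_quadratic a s s) ^^ n) (s / a))"
    using assms by simp
qed (fact assms)+

text \<open>The critical value \<open>(s - 1) / a\<close> returns to the critical point, because
  \<open>(s - 1 - s)^2 + (s - 1) = s\<close>.\<close>

lemma stable_crit_quadratic_2_cycle:
  fixes a s :: "'a::field"
  assumes "a \<noteq> 0" "is_square (-1 :: 'a)" "\<not> is_square s" "\<not> is_square (s - 1)"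
  shows "stable_poly (crit_quadratic a s (s - 1))"
proof (rule stable_crit_quadratic)
  fix n
  have "(poly (crit_quadratic a s (s - 1)) ^^ n) ((s - 1) / a) \<in> {s / a, (s - 1) / a}"
    using \<open>a \<noteq> 0\<close> by (induction n) (auto simp: poly_crit_quadratic)
  then show "\<not> is_square (a * (poly (crit_quadratic a s (s - 1)) ^^ n) ((s - 1) / a))"
    using assms by auto
qed (fact assms)+

section \<open>Squares in finite fields\<close>

lemma card_eq_mult_card_image:
  assumes "finite S" "\<And>x. x \<in> S \<Longrightarrow> card {y \<in> S. g y = g x} = k"
  shows "card S = k * card (g ` S)"
proof -
  have "card S = (\<Sum>z\<in>g ` S. card {y \<in> S. g y = z})"
    using sum.image_gen [OF assms(1), of "\<lambda>_. 1 :: nat" g] by simp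
  also have "\<dots> = (\<Sum>z\<in>g ` S. k)"
    using assms(2) by (intro sum.cong) auto
  finally show ?thesis by simp
qed

lemma even_card_if_involution_without_fixed_point:
  assumes "finite S" "\<And>x. x \<in> S \<Longrightarrow> f x \<in> S \<and> f (f x) = x \<and> f x \<noteq> x"
  shows "even (card S)"
proof -
  have "card {y \<in> S. {y, f y} = {x, f x}} = 2" if "x \<in> S" for x
  proof -
    have "{y \<in> S. {y, f y} = {x, f x}} = {x, f x}"
      using assms(2) that by (auto simp: doubleton_eq_iff)
    then show ?thesis
      using assms(2) [OF that] by (simp add: card_insert_if eq_commute)
  qed
  then have "card S = 2 * card ((\<lambda>x. {x, f x}) ` S)"
    by (intro card_eq_mult_card_image assms(1))
  then show ?thesis by simp
qed

text \<open>In characteristic 2 the shift by 1 would pair off the elements of the field.\<close>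

lemma two_neq_zero_if_odd_card:
  assumes "odd (CARD('a::{finite,field}))"
  shows "(2 :: 'a) \<noteq> 0"
proof
  assume "(2 :: 'a) = 0"
  then have "even (CARD('a))"
    by (intro even_card_if_involution_without_fixed_point [where f = "\<lambda>x. x + 1"])
      (auto simp: add.assoc)
  with assms show False by simp
qed

text \<open>Squaring is two-to-one on the nonzero elements, with fibres
  \<open>{x, - x}\<close>.\<close>

lemma card_nonzero_squares:
  assumes "(2 :: 'a::{finite,field}) \<noteq> 0"
  shows "CARD('a) = 2 * card {x :: 'a. is_square x \<and> x \<noteq> 0} + 1"
proof -
  have "card {y \<in> - {0}. y ^ 2 = x ^ 2} = 2" if "x \<in> - {0}" for x :: 'a
  proof -
    have "x \<noteq> - x"
    proof
      assume "x = - x"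
      then have "2 * x = 0" by (metis add.right_inverse mult_2)
      with assms that show False by simp
    qed
    moreover have "{y \<in> - {0}. y ^ 2 = x ^ 2} = {x, - x}"
      using that by (auto simp: power2_eq_iff)
    ultimately show ?thesis by simp
  qed
  then have "card (- {0 :: 'a}) = 2 * card ((\<lambda>x :: 'a. x ^ 2) ` (- {0}))"
    by (intro card_eq_mult_card_image) auto
  moreover have "(\<lambda>x :: 'a. x ^ 2) ` (- {0}) = {x. is_square x \<and> x \<noteq> 0}"
    by (auto simp: is_nth_power_def)
  moreover have "CARD('a) = card (- {0 :: 'a}) + 1"
    by (simp add: Compl_eq_Diff_UNIV card_Diff_singleton)
  ultimately show ?thesis by simp
qed

text \<open>
  Inversion acts on the squares other than \<open>0\<close> and \<open>1\<close>, an odd number of elements,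
  and its only possible fixed point is \<open>-1\<close>.
\<close>

lemma is_square_minus_1:
  assumes "[CARD('a::{finite,field}) = 1] (mod 4)"
  shows "is_square (-1 :: 'a)"
proof (rule ccontr)
  assume nonsquare: "\<not> is_square (-1 :: 'a)"
  have mod4: "CARD('a) mod 4 = 1"
    using assms by (simp add: cong_def)
  then have "odd (CARD('a))" by presburger
  define S where "S = {x :: 'a. is_square x \<and> x \<noteq> 0}"
  have "even (card (S - {1}))"
  proof (rule even_card_if_involution_without_fixed_point)
    fix x assume x: "x \<in> S - {1}"
    then obtain y where y: "x = y ^ 2"
      by (auto simp: S_def elim: is_nth_powerE)
    have "inverse x = inverse y ^ 2"
      by (simp add: y power_inverse)
    then have "is_square (inverse x)" by simp
    moreover have "inverse x \<noteq> x"
    proof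
      assume "inverse x = x"
      moreover have "x * inverse x = 1"
        using x by (simp add: S_def)
      ultimately have "x ^ 2 = 1" by (simp add: power2_eq_square)
      then have "x = 1 \<or> x = -1" by (simp add: power2_eq_1_iff)
      with x nonsquare show False by (auto simp: S_def)
    qed
    ultimately show "inverse x \<in> S - {1} \<and> inverse (inverse x) = x \<and> inverse x \<noteq> x"
      using x by (auto simp: S_def)
  qed simp
  \<comment> \<open>Hence \<open>card S\<close> is odd, and \<open>2 * card S + 1\<close> is 3
    modulo 4.\<close>
  moreover have "card S = card (S - {1}) + 1"
    using card.remove [of S 1] by (simp add: S_def)
  moreover have "CARD('a) = 2 * card S + 1"
    unfolding S_def
    by (rule card_nonzero_squares) (rule two_neq_zero_if_odd_card [OF \<open>odd (CARD('a))\<close>])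
  ultimately show False using mod4 by presburger
qed

text \<open>If \<open>x - 1\<close> is a square, then \<open>1 / x - 1 = - (x - 1) / x\<close> is not.\<close>

lemma consecutive_nonsquares:
  fixes x :: "'a::field"
  assumes "\<not> is_square x" "is_square (-1 :: 'a)"
  obtains s :: 'a where "\<not> is_square s" "\<not> is_square (s - 1)"
proof (cases "is_square (x - 1)")
  case False
  with assms that show ?thesis by blast
next
  case True
  then obtain y where y: "x - 1 = y ^ 2" by (auto elim: is_nth_powerE)
  obtain i :: 'a where i: "-1 = i ^ 2" using assms(2) by (auto elim: is_nth_powerE)
  have "x \<noteq> 0" "x \<noteq> 1" using assms by auto
  have "\<not> is_square (1 / x)"
  proof
    assume "is_square (1 / x)"
    then obtain z where "1 / x = z ^ 2" by (auto elim: is_nth_powerE)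
    then have "x = (1 / z) ^ 2"
      using \<open>x \<noteq> 0\<close> by (simp add: power_divide) (metis div_by_1 divide_divide_eq_right mult_1)
    with assms show False by simp
  qed
  moreover have "\<not> is_square (1 / x - 1)"
  proof
    assume "is_square (1 / x - 1)"
    then obtain z where z: "1 / x - 1 = z ^ 2" by (auto elim: is_nth_powerE)
    have "1 / x - 1 = (-1) * (x - 1) / x"
      using \<open>x \<noteq> 0\<close> by (simp add: field_simps)
    then have "z ^ 2 * x = (i * y) ^ 2"
      using \<open>x \<noteq> 0\<close> by (simp add: z i y power_mult_distrib)
    moreover have "z \<noteq> 0"
      using z \<open>x \<noteq> 0\<close> \<open>x \<noteq> 1\<close> by (auto simp: field_simps)
    ultimately have "x = (i * y / z) ^ 2"
      by (simp add: field_simps power_divide)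
    with assms show False by simp
  qed
  ultimately show ?thesis by (rule that)
qed

section \<open>Counting the constructed polynomials\<close>

theorem corollary3p2:
  fixes q :: nat
  assumes "primepow q"
    and "[q = 1] (mod 4)"
    and "CARD('a::{finite,field}) = q"
  shows "real (card {t :: 'a poly. degree t = 2 \<and> stable_poly t}) \<ge> (real q ^ 2 - 1) / 2"
proof -
  let ?stable = "{t :: 'a poly. degree t = 2 \<and> stable_poly t}"
  define N where "N = {x :: 'a. \<not> is_square x}"
  have minus1: "is_square (-1 :: 'a)"
    using assms by (intro is_square_minus_1) simp
  have "odd q" using assms(2) unfolding cong_def by presburger
  then have two: "(2 :: 'a) \<noteq> 0"
    using assms(3) by (intro two_neq_zero_if_odd_card) simp
  have "q > 1" using assms(1) by (rule primepow_gt_Suc_0 [unfolded One_nat_def [symmetric]])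
  have cardN: "q = 2 * card N + 1"
  proof -
    \<comment> \<open>Zero counts as a square, so \<open>N\<close> has exactly
      \<open>(q - 1) / 2\<close> elements.\<close>
    have "- N = insert 0 {x. is_square x \<and> x \<noteq> 0}"
      by (auto simp: N_def)
    then have "card (- N) = card {x :: 'a. is_square x \<and> x \<noteq> 0} + 1"
      by simp
    moreover have "card N + card (- N) = q"
      using assms(3) by (metis Compl_partition card_Un_disjoint Compl_disjoint finite)
    ultimately show ?thesis
      using card_nonzero_squares [OF two] assms(3) by simp
  qed
  then have "N \<noteq> {}" using \<open>q > 1\<close> by auto
  then obtain s0 :: 'a where s0: "\<not> is_square s0" "\<not> is_square (s0 - 1)"
    using consecutive_nonsquares minus1 unfolding N_def by blast
  \<comment> \<open>Admissible pairs \<open>(s, m)\<close>: the diagonal gives fixed points, and the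
    one off-diagonal pair gives the 2-cycle.\<close>
  define I where "I = insert (s0, s0 - 1) ((\<lambda>s. (s, s)) ` N)"
  define F where "F = (\<lambda>(a :: 'a, s, m). crit_quadratic a s m)"
  have "card I = card N + 1"
    unfolding I_def by (subst card_insert_disjoint) (auto simp: card_image inj_on_def)
  moreover have "card (- {0 :: 'a}) = q - 1"
    using assms(3) by (simp add: Compl_eq_Diff_UNIV card_Diff_singleton)
  ultimately have "card ((- {0 :: 'a}) \<times> I) = (q - 1) * (card N + 1)"
    by (simp add: card_cartesian_product)
  \<comment> \<open>The coefficients \<open>a\<close>, \<open>- 2 * s\<close> and
    \<open>(s ^ 2 + m) / a\<close> determine \<open>a\<close>, \<open>s\<close> and \<open>m\<close>
    in turn, as 2 is invertible.\<close>
  moreover have "inj_on F ((- {0}) \<times> I)"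
    using two by (auto simp: inj_on_def F_def crit_quadratic_def)
  ultimately have cardF: "card (F ` ((- {0}) \<times> I)) = (q - 1) * (card N + 1)"
    by (simp add: card_image)
  have "F ` ((- {0}) \<times> I) \<subseteq> ?stable"
    using s0 minus1
    by (auto simp: F_def I_def N_def stable_crit_quadratic_fixed stable_crit_quadratic_2_cycle)
  \<comment> \<open>Finiteness matters because \<open>card\<close> of an infinite set is 0.\<close>
  moreover have "finite ?stable"
  proof (rule finite_subset)
    show "?stable \<subseteq> Poly ` {xs. set xs \<subseteq> UNIV \<and> length xs \<le> 3}"
    proof
      fix t :: "'a poly" assume "t \<in> ?stable"
      then have "length (coeffs t) \<le> 3"
        by (cases "t = 0") (simp_all add: length_coeffs_degree)
      then show "t \<in> Poly ` {xs. set xs \<subseteq> UNIV \<and> length xs \<le> 3}"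
        by (intro image_eqI [of _ _ "coeffs t"]) auto
    qed
  qed (intro finite_imageI finite_lists_length_le finite)
  ultimately have "(q - 1) * (card N + 1) \<le> card ?stable"
    using card_mono cardF by metis
  then have "real ((q - 1) * (card N + 1)) \<le> real (card ?stable)"
    by (simp only: of_nat_le_iff)
  moreover have "real ((q - 1) * (card N + 1)) = (real q ^ 2 - 1) / 2"
    by (simp add: cardN power2_eq_square algebra_simps)
  ultimately show ?thesis by simp
qed

end
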